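(* Let $N\ge 2$, $\eta\ge 0$, and let $\mathbf p=(p_1,\dots,p_N)$ be an optimal solution (optimal price vector) of either Formulation 1 or Formulation 2 of the retailer's problem with parameter $\eta$ (both defined in the context). Then for all consumers $i,j\in\{1,\dots,N\}$: if $\omega_i>\omega_j$ then $p_i\ge p_j$; and if $\omega_i=\omega_j$ then $p_i=p_j$.
   Context: A retailer sets unit prices $p_1,\dots,p_N\in\mathbb R$ for $N$ consumers in a fixed time period. Consumer $i$ has a preference parameter $\omega_i>0$ (willingness for demand), known to the retailer. $\alpha>0$ is a constant, $e_1,e_2,e_3>0$ are weights, $p_b\le P$ are the lower (base) and upper price limits, and $\eta\ge 0$ bounds the price discrimination between consumers. Define $$f_1(p)=e_1\sum_{i=1}^N p_i\,\frac{\omega_i-p_i}{\alpha}-\frac{e_2}{N}\Big(\sum_{i=1}^N\frac{\omega_i-p_i}{\alpha}\Big)^2-e_3\sum_{i=1}^N\Big(\frac{p_i}{\alpha}\Big)^2,\qquad f_2(p)=f_1(p)+\sum_{i=1}^N\min\Big(0,\frac{\omega_i-p_i}{\alpha}\Big).$$ Formulation 1: maximize $f_1(p)$ over $p\in\mathbb R^N$ subject to $-\eta\le p_i-p_j\le\eta$ for all $i\ne j$, $p_b\le p_i\le P$ for all $i$, and $p_i\le\omega_i$ for all $i$. Formulation 2: maximize $f_2(p)$ over $p\in\mathbb R^N$ subject to $-\eta\le p_i-p_j\le\eta$ for all $i\ne j$ and $p_b\le p_i\le P$ for all $i$. *)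

theory Defs
  imports "HOL-Analysis.Analysis"
begin

text \<open>
  Consumers are the elements of a finite index type \<open>'n\<close>, so \<open>N = CARD('n)\<close>.
  The demand of consumer \<open>i\<close> at price vector \<open>p\<close> is \<open>(\<omega>$i - p$i) / \<alpha>\<close>.
\<close>

definition f1 :: "real \<Rightarrow> real \<Rightarrow> real \<Rightarrow> real \<Rightarrow> real ^ 'n \<Rightarrow> real ^ 'n \<Rightarrow> real" where
  "f1 e1 e2 e3 \<alpha> \<omega> p =
     e1 * (\<Sum>i\<in>UNIV. p $ i * ((\<omega> $ i - p $ i) / \<alpha>))
     - e2 / real CARD('n) * (\<Sum>i\<in>UNIV. (\<omega> $ i - p $ i) / \<alpha>)\<^sup>2
     - e3 * (\<Sum>i\<in>UNIV. (p $ i / \<alpha>)\<^sup>2)"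

definition f2 :: "real \<Rightarrow> real \<Rightarrow> real \<Rightarrow> real \<Rightarrow> real ^ 'n \<Rightarrow> real ^ 'n \<Rightarrow> real" where
  "f2 e1 e2 e3 \<alpha> \<omega> p =
     f1 e1 e2 e3 \<alpha> \<omega> p + (\<Sum>i\<in>UNIV. min 0 ((\<omega> $ i - p $ i) / \<alpha>))"

definition feasible2 :: "real \<Rightarrow> real \<Rightarrow> real \<Rightarrow> real ^ 'n \<Rightarrow> bool" where
  "feasible2 \<eta> pb P p \<longleftrightarrow>
     (\<forall>i j. i \<noteq> j \<longrightarrow> - \<eta> \<le> p $ i - p $ j \<and> p $ i - p $ j \<le> \<eta>) \<and>
     (\<forall>i. pb \<le> p $ i \<and> p $ i \<le> P)"

definition feasible1 :: "real \<Rightarrow> real \<Rightarrow> real \<Rightarrow> real ^ 'n \<Rightarrow> real ^ 'n \<Rightarrow> bool" where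
  "feasible1 \<eta> pb P \<omega> p \<longleftrightarrow> feasible2 \<eta> pb P p \<and> (\<forall>i. p $ i \<le> \<omega> $ i)"

text \<open>An optimal solution is a global maximiser over the feasible set.\<close>

definition optimal1 ::
  "real \<Rightarrow> real \<Rightarrow> real \<Rightarrow> real \<Rightarrow> real \<Rightarrow> real \<Rightarrow> real \<Rightarrow> real ^ 'n \<Rightarrow> real ^ 'n \<Rightarrow> bool" where
  "optimal1 e1 e2 e3 \<alpha> \<eta> pb P \<omega> p \<longleftrightarrow>
     is_arg_max (f1 e1 e2 e3 \<alpha> \<omega>) (feasible1 \<eta> pb P \<omega>) p"

definition optimal2 ::
  "real \<Rightarrow> real \<Rightarrow> real \<Rightarrow> real \<Rightarrow> real \<Rightarrow> real \<Rightarrow> real \<Rightarrow> real ^ 'n \<Rightarrow> real ^ 'n \<Rightarrow> bool" where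
  "optimal2 e1 e2 e3 \<alpha> \<eta> pb P \<omega> p \<longleftrightarrow>
     is_arg_max (f2 e1 e2 e3 \<alpha> \<omega>) (feasible2 \<eta> pb P) p"

end

theory Submission
  imports Defs
begin

text \<open>
  Suppose a consumer \<open>i\<close> who is at least as willing as \<open>j\<close>, i.e. \<open>\<omega>$j \<le> \<omega>$i\<close>, is charged strictly
  less than \<open>j\<close>. Charge both of them the mean of their two prices instead. This preserves the sum
  of all prices, hence the total demand and the quadratic demand penalty. It strictly raises the
  revenue, for two reasons: the revenue is strictly concave in the prices, and price mass
  moves from \<open>j\<close> to the at least equally willing \<open>i\<close>. The sum of squared prices does not grow, and
  neither does the loss from negative demands (\<open>min 0\<close> is concave, and the two demands move
  towards each other with constant sum). All constraints survive averaging, so the price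
  vector was not optimal, for either formulation (\<open>f1_pool_less\<close>, \<open>f2_pool_less\<close>,
  \<open>feasible1_pool\<close>, \<open>feasible2_pool\<close>).

  Hence \<open>\<omega>$j \<le> \<omega>$i\<close> implies \<open>p$j \<le> p$i\<close>. This yields both claims at once: equality of the prices
  for \<open>\<omega>$i = \<omega>$j\<close> follows by exchanging \<open>i\<close> and \<open>j\<close>.
\<close>

definition pool :: "'n \<Rightarrow> 'n \<Rightarrow> real ^ 'n \<Rightarrow> real ^ 'n" where
  "pool i j p = (\<chi> k. if k = i \<or> k = j then (p $ i + p $ j) / 2 else p $ k)"

text \<open>Each sum in the objective functions is separable in the consumers, so that pooling two prices
  changes it by two local differences.\<close>

lemma sum_pool:
  fixes h :: "'n::finite \<Rightarrow> real \<Rightarrow> real"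
  assumes "i \<noteq> j"
  shows "(\<Sum>k\<in>UNIV. h k (pool i j p $ k)) = (\<Sum>k\<in>UNIV. h k (p $ k))
     + (h i ((p $ i + p $ j) / 2) - h i (p $ i)) + (h j ((p $ i + p $ j) / 2) - h j (p $ j))"
proof -
  have "(\<Sum>k\<in>UNIV. h k (pool i j p $ k)) - (\<Sum>k\<in>UNIV. h k (p $ k))
      = (\<Sum>k\<in>UNIV. h k (pool i j p $ k) - h k (p $ k))"
    by (simp add: sum_subtractf)
  also have "\<dots> = (\<Sum>k\<in>{i, j}. h k (pool i j p $ k) - h k (p $ k))"
    by (rule sum.mono_neutral_right) (auto simp: pool_def)
  also have "\<dots> = (h i ((p $ i + p $ j) / 2) - h i (p $ i)) + (h j ((p $ i + p $ j) / 2) - h j (p $ j))"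
    using assms by (simp add: pool_def)
  finally show ?thesis by simp
qed

lemma feasible2_pool:
  assumes "feasible2 \<eta> pb P p" and "\<eta> \<ge> 0"
  shows "feasible2 \<eta> pb P (pool i j p)"
proof -
  have diff: "p $ k - p $ l \<le> \<eta>" for k l
    using assms unfolding feasible2_def by (cases "k = l") auto
  have bounds: "pb \<le> p $ k" "p $ k \<le> P" for k
    using assms(1) unfolding feasible2_def by auto
  have "pool i j p $ k - pool i j p $ l \<le> \<eta>" for k l
    using diff[of k i] diff[of k j] diff[of i l] diff[of j l] diff[of k l] \<open>\<eta> \<ge> 0\<close>
    unfolding pool_def by (auto simp: field_simps)
  moreover have "- \<eta> \<le> pool i j p $ k - pool i j p $ l" for k l
    using calculation[of l k] by linarith
  moreover have "pb \<le> pool i j p $ k \<and> pool i j p $ k \<le> P" for k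
    using bounds[of i] bounds[of j] bounds[of k] unfolding pool_def by auto
  ultimately show ?thesis
    unfolding feasible2_def by blast
qed

text \<open>The cap \<open>p$k \<le> \<omega>$k\<close> is not symmetric in the consumers. It survives because the mean is at most
  \<open>p$j\<close>, which in turn is at most \<open>\<omega>$j\<close>, the smaller of the two caps.\<close>

lemma feasible1_pool:
  assumes "feasible1 \<eta> pb P \<omega> p" and "\<eta> \<ge> 0" and "\<omega> $ j \<le> \<omega> $ i" and "p $ i \<le> p $ j"
  shows "feasible1 \<eta> pb P \<omega> (pool i j p)"
proof -
  have cap: "p $ k \<le> \<omega> $ k" for k
    using assms(1) unfolding feasible1_def by blast
  have "pool i j p $ k \<le> \<omega> $ k" for k
    using cap[of k] cap[of j] assms(3,4) unfolding pool_def by auto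
  then show ?thesis
    using assms(1,2) feasible2_pool unfolding feasible1_def by blast
qed

lemma f1_pool_less:
  fixes \<omega> p :: "real ^ 'n"
  assumes "e1 > 0" and "e3 \<ge> 0" and "\<alpha> > 0" and "\<omega> $ j \<le> \<omega> $ i" and "p $ i < p $ j"
  shows "f1 e1 e2 e3 \<alpha> \<omega> p < f1 e1 e2 e3 \<alpha> \<omega> (pool i j p)"
proof -
  have ij: "i \<noteq> j"
    using assms(5) by auto
  define m where "m = (p $ i + p $ j) / 2"
  have demand: "(\<Sum>k\<in>UNIV. (\<omega> $ k - pool i j p $ k) / \<alpha>) = (\<Sum>k\<in>UNIV. (\<omega> $ k - p $ k) / \<alpha>)"
    using sum_pool[OF ij, of "\<lambda>k x. (\<omega> $ k - x) / \<alpha>" p] \<open>\<alpha> > 0\<close> by (simp add: field_simps)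
  have "(\<Sum>k\<in>UNIV. pool i j p $ k * ((\<omega> $ k - pool i j p $ k) / \<alpha>))
      = (\<Sum>k\<in>UNIV. p $ k * ((\<omega> $ k - p $ k) / \<alpha>))
        + (m * (\<omega> $ i - m) - p $ i * (\<omega> $ i - p $ i)
           + (m * (\<omega> $ j - m) - p $ j * (\<omega> $ j - p $ j))) / \<alpha>"
    using sum_pool[OF ij, of "\<lambda>k x. x * ((\<omega> $ k - x) / \<alpha>)" p, folded m_def]
    unfolding times_divide_eq_right
    by (simp only: diff_divide_distrib add_divide_distrib add.assoc)
  \<comment> \<open>The first summand is the gain from moving price mass to the more willing consumer, the second
      the gain from strict concavity.\<close>
  also have "m * (\<omega> $ i - m) - p $ i * (\<omega> $ i - p $ i) + (m * (\<omega> $ j - m) - p $ j * (\<omega> $ j - p $ j))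
      = (p $ j - p $ i) * (\<omega> $ i - \<omega> $ j) / 2 + (p $ j - p $ i)\<^sup>2 / 2"
    unfolding m_def by (simp add: field_simps power2_eq_square)
  finally have "(\<Sum>k\<in>UNIV. pool i j p $ k * ((\<omega> $ k - pool i j p $ k) / \<alpha>))
      = (\<Sum>k\<in>UNIV. p $ k * ((\<omega> $ k - p $ k) / \<alpha>))
        + ((p $ j - p $ i) * (\<omega> $ i - \<omega> $ j) / 2 + (p $ j - p $ i)\<^sup>2 / 2) / \<alpha>" .
  moreover have "((p $ j - p $ i) * (\<omega> $ i - \<omega> $ j) / 2 + (p $ j - p $ i)\<^sup>2 / 2) / \<alpha> > 0"
    using assms by (intro divide_pos_pos add_nonneg_pos) auto
  ultimately have revenue: "e1 * (\<Sum>k\<in>UNIV. p $ k * ((\<omega> $ k - p $ k) / \<alpha>))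
      < e1 * (\<Sum>k\<in>UNIV. pool i j p $ k * ((\<omega> $ k - pool i j p $ k) / \<alpha>))"
    using \<open>e1 > 0\<close> by simp
  have "((m / \<alpha>)\<^sup>2 - (p $ i / \<alpha>)\<^sup>2) + ((m / \<alpha>)\<^sup>2 - (p $ j / \<alpha>)\<^sup>2)
      = - ((p $ i - p $ j) / \<alpha>)\<^sup>2 / 2"
    using \<open>\<alpha> > 0\<close> unfolding m_def by (simp add: field_simps power2_eq_square)
  moreover have "((p $ i - p $ j) / \<alpha>)\<^sup>2 \<ge> 0"
    by (rule zero_le_power2)
  ultimately have "(\<Sum>k\<in>UNIV. (pool i j p $ k / \<alpha>)\<^sup>2) \<le> (\<Sum>k\<in>UNIV. (p $ k / \<alpha>)\<^sup>2)"
    using sum_pool[OF ij, of "\<lambda>k x. (x / \<alpha>)\<^sup>2" p, folded m_def] by linarith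
  then have "e3 * (\<Sum>k\<in>UNIV. (pool i j p $ k / \<alpha>)\<^sup>2) \<le> e3 * (\<Sum>k\<in>UNIV. (p $ k / \<alpha>)\<^sup>2)"
    using \<open>e3 \<ge> 0\<close> by (intro mult_left_mono) auto
  then show ?thesis
    using revenue unfolding f1_def demand by linarith
qed

lemma f2_pool_less:
  fixes \<omega> p :: "real ^ 'n"
  assumes "e1 > 0" and "e3 \<ge> 0" and "\<alpha> > 0" and "\<omega> $ j \<le> \<omega> $ i" and "p $ i < p $ j"
  shows "f2 e1 e2 e3 \<alpha> \<omega> p < f2 e1 e2 e3 \<alpha> \<omega> (pool i j p)"
proof -
  have ij: "i \<noteq> j"
    using assms(5) by auto
  define m where "m = (p $ i + p $ j) / 2"
  have mean: "p $ i \<le> m" "m \<le> p $ j"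
    using assms(5) unfolding m_def by auto
  define a b c d where
    "a = (\<omega> $ i - p $ i) / \<alpha>" and "b = (\<omega> $ j - p $ j) / \<alpha>" and
    "c = (\<omega> $ i - m) / \<alpha>" and "d = (\<omega> $ j - m) / \<alpha>"
  \<comment> \<open>The new demands \<open>c\<close>, \<open>d\<close> lie between the old ones \<open>b \<le> a\<close> and have the same sum, which is the
      situation in which concavity of \<open>min 0\<close> applies.\<close>
  have "c + d = a + b"
    using \<open>\<alpha> > 0\<close> unfolding a_def b_def c_def d_def m_def by (simp add: field_simps)
  moreover have "c \<le> a" "b \<le> c" "b \<le> d"
    using mean \<open>\<alpha> > 0\<close> \<open>\<omega> $ j \<le> \<omega> $ i\<close> unfolding a_def b_def c_def d_def
    by (simp_all add: divide_right_mono)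
  ultimately have "min 0 a + min 0 b \<le> min 0 c + min 0 d"
    by (auto simp: min_def)
  then have "(\<Sum>k\<in>UNIV. min 0 ((\<omega> $ k - p $ k) / \<alpha>))
      \<le> (\<Sum>k\<in>UNIV. min 0 ((\<omega> $ k - pool i j p $ k) / \<alpha>))"
    unfolding a_def b_def c_def d_def m_def
    using sum_pool[OF ij, of "\<lambda>k x. min 0 ((\<omega> $ k - x) / \<alpha>)" p] by linarith
  then show ?thesis
    using f1_pool_less[OF assms] unfolding f2_def by (intro add_less_le_mono)
qed

lemma optimal_price_mono:
  fixes \<omega> p :: "real ^ 'n"
  assumes "e1 > 0" and "e3 \<ge> 0" and "\<alpha> > 0" and "\<eta> \<ge> 0"
    and opt: "optimal1 e1 e2 e3 \<alpha> \<eta> pb P \<omega> p \<or> optimal2 e1 e2 e3 \<alpha> \<eta> pb P \<omega> p"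
    and le: "\<omega> $ j \<le> \<omega> $ i"
  shows "p $ j \<le> p $ i"
proof (rule ccontr)
  assume "\<not> p $ j \<le> p $ i"
  then have less: "p $ i < p $ j" by simp
  from opt show False
  proof
    assume "optimal1 e1 e2 e3 \<alpha> \<eta> pb P \<omega> p"
    then show False
      using feasible1_pool[OF _ \<open>\<eta> \<ge> 0\<close> le less_imp_le[OF less]]
        f1_pool_less[where \<omega> = \<omega> and p = p, OF assms(1-3) le less]
      unfolding optimal1_def is_arg_max_def by blast
  next
    assume "optimal2 e1 e2 e3 \<alpha> \<eta> pb P \<omega> p"
    then show False
      using feasible2_pool[OF _ \<open>\<eta> \<ge> 0\<close>]
        f2_pool_less[where \<omega> = \<omega> and p = p, OF assms(1-3) le less]
      unfolding optimal2_def is_arg_max_def by blast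
  qed
qed

theorem theorem2:
  fixes e1 e2 e3 \<alpha> \<eta> pb P :: real
    and \<omega> p :: "real ^ 'n"
  assumes "CARD('n) \<ge> 2"
    and "e1 > 0" and "e2 > 0" and "e3 > 0" and "\<alpha> > 0"
    and "\<And>i. \<omega> $ i > 0"
    and "pb \<le> P" and "\<eta> \<ge> 0"
    and "optimal1 e1 e2 e3 \<alpha> \<eta> pb P \<omega> p \<or> optimal2 e1 e2 e3 \<alpha> \<eta> pb P \<omega> p"
  shows "\<forall>i j. (\<omega> $ i > \<omega> $ j \<longrightarrow> p $ i \<ge> p $ j) \<and> (\<omega> $ i = \<omega> $ j \<longrightarrow> p $ i = p $ j)"
proof -
  have "p $ j \<le> p $ i" if "\<omega> $ j \<le> \<omega> $ i" for i j
    using optimal_price_mono[OF assms(2) less_imp_le[OF assms(4)] assms(5,8,9) that] .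
  then show ?thesis
    by (simp add: order_antisym)
qed

end
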